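(* Let $N, W, L, M$ be positive integers and $\mathbf{w}\in\mathbb{C}^W$ a window such that (i) $\mathbf{w}$ is non-vanishing ($w[n]\neq0$ for $0\le n\le W-1$); (ii) $2L\le W\le \frac{N}{2}$; (iii) $4L\le M\le N$. Then for almost all non-vanishing $\mathbf{x}_0\in\mathbb{C}^N$ (all $\mathbf{x}_0$ with every entry nonzero, except a Lebesgue-null set), when the entries $x_0[n]$, $0\le n\le\lfloor L/2\rfloor$, are known a priori, the only $N\times N$ Hermitian positive semidefinite matrix $\mathbf{X}$ satisfying $$\operatorname{trace}(\mathbf{W}_r^\star\mathbf{f}_m\mathbf{f}_m^\star\mathbf{W}_r\mathbf{X})=Z_w[m,r]\quad\text{for all }1\le m\le M,\ 0\le r\le R-1,$$ together with the prior-information constraints $X[n,k]=x_0[n]\overline{x_0[k]}$ for $0\le n,k\le\lfloor L/2\rfloor$, is $\mathbf{X}_0=\mathbf{x}_0\mathbf{x}_0^\star$. In particular, the semidefinite program minimizing $\operatorname{trace}(\mathbf{X})$ over these constraints has the unique feasible (hence optimal) point $\mathbf{x}_0\mathbf{x}_0^\star$.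
   Context: The window is extended by $w[k]=0$ for $k\notin\{0,\dots,W-1\}$; $R=\lceil (N+W-1)/L\rceil$. For $0\le r\le R-1$, $\mathbf{W}_r$ is the $N\times N$ diagonal matrix with diagonal entries $w[rL-n]$, $n=0,\dots,N-1$. For integer $m$, $\mathbf{f}_m\in\mathbb{C}^N$ has entries $f_m[n]=e^{i2\pi mn/N}$ (the conjugate of the $m$th column of the $N$-point DFT matrix, indices modulo $N$), and $\star$ denotes conjugate transpose. The measurements are the STFT magnitudes of $\mathbf{x}_0$: $Z_w[m,r]=|\mathbf{f}_m^\star\mathbf{W}_r\mathbf{x}_0|^2=\big|\sum_{n=0}^{N-1}x_0[n]w[rL-n]e^{-i2\pi mn/N}\big|^2$. The a priori knowledge of the entries $x_0[n]$, $0\le n\le\lfloor L/2\rfloor$, is incorporated into the program as the linear constraints on the corresponding block of $\mathbf{X}$ stated in the claim. *)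

theory Defs
  imports "HOL-Analysis.Analysis"
begin

text \<open>Vectors in C^N are functions nat => complex (entries at indices < N);
  N x N matrices are functions nat => nat => complex (entries at indices < N).\<close>

definition wext :: "nat \<Rightarrow> (nat \<Rightarrow> complex) \<Rightarrow> int \<Rightarrow> complex" where
  "wext W w k = (if 0 \<le> k \<and> k < int W then w (nat k) else 0)"

definition num_frames :: "nat \<Rightarrow> nat \<Rightarrow> nat \<Rightarrow> int" where
  "num_frames N W L = \<lceil>(real N + real W - 1) / real L\<rceil>"

definition fvec :: "nat \<Rightarrow> int \<Rightarrow> nat \<Rightarrow> complex" where
  "fvec N m n = exp (\<i> * of_real (2 * pi * real_of_int m * real n / real N))"

definition Wmat :: "nat \<Rightarrow> (nat \<Rightarrow> complex) \<Rightarrow> nat \<Rightarrow> int \<Rightarrow> nat \<Rightarrow> nat \<Rightarrow> complex" where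
  "Wmat W w L r n k = (if n = k then wext W w (r * int L - int n) else 0)"

definition mat_mult :: "nat \<Rightarrow> (nat \<Rightarrow> nat \<Rightarrow> complex) \<Rightarrow> (nat \<Rightarrow> nat \<Rightarrow> complex) \<Rightarrow> nat \<Rightarrow> nat \<Rightarrow> complex" where
  "mat_mult N A B = (\<lambda>i j. \<Sum>k<N. A i k * B k j)"

definition adjoint :: "(nat \<Rightarrow> nat \<Rightarrow> complex) \<Rightarrow> nat \<Rightarrow> nat \<Rightarrow> complex" where
  "adjoint A = (\<lambda>i j. cnj (A j i))"

definition outer :: "(nat \<Rightarrow> complex) \<Rightarrow> (nat \<Rightarrow> complex) \<Rightarrow> nat \<Rightarrow> nat \<Rightarrow> complex" where
  "outer u v = (\<lambda>i j. u i * cnj (v j))"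

definition mtrace :: "nat \<Rightarrow> (nat \<Rightarrow> nat \<Rightarrow> complex) \<Rightarrow> complex" where
  "mtrace N A = (\<Sum>i<N. A i i)"

definition hermitian :: "nat \<Rightarrow> (nat \<Rightarrow> nat \<Rightarrow> complex) \<Rightarrow> bool" where
  "hermitian N X \<longleftrightarrow> (\<forall>i<N. \<forall>j<N. X i j = cnj (X j i))"

definition psd :: "nat \<Rightarrow> (nat \<Rightarrow> nat \<Rightarrow> complex) \<Rightarrow> bool" where
  "psd N X \<longleftrightarrow> (\<forall>v :: nat \<Rightarrow> complex.
     let q = (\<Sum>i<N. \<Sum>j<N. cnj (v i) * X i j * v j) in Im q = 0 \<and> 0 \<le> Re q)"

text \<open>STFT magnitude measurements Z_w[m,r] = |f_m^* W_r x0|^2.\<close>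
definition Zw :: "nat \<Rightarrow> nat \<Rightarrow> (nat \<Rightarrow> complex) \<Rightarrow> nat \<Rightarrow> (nat \<Rightarrow> complex) \<Rightarrow> int \<Rightarrow> int \<Rightarrow> real" where
  "Zw N W w L x0 m r =
     (cmod (\<Sum>n<N. x0 n * wext W w (r * int L - int n)
                 * exp (- \<i> * of_real (2 * pi * real_of_int m * real n / real N))))\<^sup>2"

definition feasible :: "nat \<Rightarrow> nat \<Rightarrow> (nat \<Rightarrow> complex) \<Rightarrow> nat \<Rightarrow> nat \<Rightarrow> (nat \<Rightarrow> complex)
    \<Rightarrow> (nat \<Rightarrow> nat \<Rightarrow> complex) \<Rightarrow> bool" where
  "feasible N W w L M x0 X \<longleftrightarrow>
     hermitian N X \<and> psd N X \<and>
     (\<forall>m::int. \<forall>r::int. 1 \<le> m \<and> m \<le> int M \<and> 0 \<le> r \<and> r \<le> num_frames N W L - 1 \<longrightarrow>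
        mtrace N (mat_mult N (mat_mult N (mat_mult N (adjoint (Wmat W w L r))
             (outer (fvec N m) (fvec N m))) (Wmat W w L r)) X)
        = complex_of_real (Zw N W w L x0 m r)) \<and>
     (\<forall>n\<le>L div 2. \<forall>k\<le>L div 2. X n k = x0 n * cnj (x0 k))"

end

theory Submission
  imports "Jordan_Normal_Form.Char_Poly" Defs
begin

text \<open>The matrix \<open>X\<close> is determined frame by frame: frame \<open>r\<close> sees \<open>K \<le> L\<close> new entries next to at least \<open>K\<close>
  entries on which \<open>X\<close> is already known to agree with the rank-one matrix of \<open>x\<^sub>0\<close>. By positive
  semidefiniteness, the block of \<open>X\<close> coupling new and known indices is rank one as well, hence given by \<open>K\<close> unknown
  numbers \<open>\<epsilon>\<close>, and the measurements become real-linear in \<open>\<epsilon>\<close> and the block of new indices.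
  Among \<open>4 * K - 1\<close> samples one can single out the lags \<open>K, \<dots>, 2 * K - 1\<close>; these do not see the new
  block, and the known entry at distance \<open>K\<close> enters them as a multiple of the identity. The resulting
  determinant is thus a characteristic polynomial in the real part of that entry, so that it vanishes only
  on a null set and otherwise forces \<open>\<epsilon> = 0\<close>. Finally, lag \<open>0\<close> fixes the trace of the (weighted) new block,
  whose diagonal is bounded below by positive semidefiniteness.\<close>

section \<open>Null sets detected on horizontal lines of one complex coordinate\<close>

text \<open>Lebesgue measure is determined by its values on boxes, and a complex box is a product of
  two intervals. This allows Fubini in real and imaginary part.\<close>

lemma lborel_complex_eq_distr:
  "(lborel :: complex measure) = distr (lborel \<Otimes>\<^sub>M lborel) borel (\<lambda>(a, b). Complex a b)"
proof (rule lborel_eqI)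
  fix l u :: complex
  assume le: "\<And>b. b \<in> Basis \<Longrightarrow> l \<bullet> b \<le> u \<bullet> b"
  have lu: "Re l \<le> Re u" "Im l \<le> Im u"
    using le[of 1] le[of \<i>] by (auto simp: Basis_complex_def)
  have meas: "(\<lambda>(a, b). Complex a b) \<in> lborel \<Otimes>\<^sub>M lborel \<rightarrow>\<^sub>M borel"
    unfolding Complex_eq by measurable
  have vim: "(\<lambda>(a, b). Complex a b) -` box l u = box (Re l) (Re u) \<times> box (Im l) (Im u)"
    by (auto simp: in_box_complex_iff box_real)
  have "emeasure (distr (lborel \<Otimes>\<^sub>M lborel) borel (\<lambda>(a, b). Complex a b)) (box l u)
      = emeasure (lborel \<Otimes>\<^sub>M lborel) (box (Re l) (Re u) \<times> box (Im l) (Im u))"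
    by (subst emeasure_distr[OF meas]) (auto simp: vim space_pair_measure)
  also have "\<dots> = ennreal ((Re u - Re l) * (Im u - Im l))"
    using lu by (subst lborel.emeasure_pair_measure_Times) (auto simp: ennreal_mult)
  also have "\<dots> = ennreal (\<Prod>b\<in>Basis. (u - l) \<bullet> b)"
    by (simp add: Basis_complex_def)
  finally show "emeasure (distr (lborel \<Otimes>\<^sub>M lborel) borel (\<lambda>(a, b). Complex a b)) (box l u)
      = ennreal (\<Prod>b\<in>Basis. (u - l) \<bullet> b)" .
qed simp

text \<open>Fubini over the lines \<open>Im c = b\<close>. Horizontal lines suit the later
  determinants, which mix \<open>x i\<close> with its conjugate: they are not holomorphic in
  \<open>x i\<close>, but monic polynomials in \<open>Re (x i)\<close>.\<close>

lemma AE_lborel_complex_horizontal: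
  assumes meas: "{c. P c} \<in> sets borel" and fin: "\<And>b. finite {a. \<not> P (Complex a b)}"
  shows "AE c in (lborel :: complex measure). P c"
proof -
  have m: "(\<lambda>(a, b). Complex a b) \<in> lborel \<Otimes>\<^sub>M lborel \<rightarrow>\<^sub>M borel"
    unfolding Complex_eq by measurable
  have mP: "Measurable.pred borel P"
    using meas by (simp add: pred_def)
  have pm: "Measurable.pred (lborel \<Otimes>\<^sub>M lborel) (\<lambda>z. P (Complex (fst z) (snd z)))"
    using measurable_compose[OF m mP] by (simp add: case_prod_unfold)
  have "AE b in lborel. AE a in lborel. P (Complex a b)"
  proof (rule AE_I2)
    show "AE a in lborel. P (Complex a b)" for b
      using finite_imp_null_set_lborel[OF fin[of b]] by (rule AE_I') auto
  qed
  moreover have "(AE a in lborel. AE b in lborel. P (Complex a b)) \<longleftrightarrow>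
      (AE b in lborel. AE a in lborel. P (Complex a b))"
    using predE[OF pm] by (intro lborel_pair.AE_commute)
  ultimately have "AE a in lborel. AE b in lborel. P (Complex a b)"
    by simp
  hence "AE z in lborel \<Otimes>\<^sub>M lborel. P (Complex (fst z) (snd z))"
    using predE[OF pm] by (intro lborel_pair.AE_pair_measure) simp_all
  thus ?thesis
    using meas by (subst lborel_complex_eq_distr, subst AE_distr_iff[OF m]) (auto simp: case_prod_unfold)
qed

text \<open>The indicator of the exceptional set is integrated over coordinate \<open>i\<close>
  first; this inner integral vanishes for every choice of the other coordinates.\<close>

lemma AE_PiM_coordinate:
  fixes N :: nat and P :: "(nat \<Rightarrow> complex) \<Rightarrow> bool"
  assumes "i < N"
    and meas: "Measurable.pred (PiM {..<N} (\<lambda>_. lborel)) P"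
    and fin: "\<And>x b. finite {a. \<not> P (x(i := Complex a b))}"
  shows "AE x in PiM {..<N} (\<lambda>_. (lborel :: complex measure)). P x"
proof -
  interpret product_sigma_finite "\<lambda>_::nat. (lborel :: complex measure)"
    by standard
  define I where "I = {..<N} - {i}"
  have I: "finite I" "i \<notin> I" "insert i I = {..<N}"
    using assms(1) by (auto simp: I_def)
  have meas': "Measurable.pred (PiM (insert i I) (\<lambda>_. lborel)) P"
    using meas by (simp only: I)
  have zero: "(\<integral>\<^sup>+ y. indicator {x. \<not> P x} (x(i := y)) \<partial>lborel) = 0"
    if x: "x \<in> space (PiM I (\<lambda>_. lborel))" for x
  proof -
    have "(\<lambda>y. x(i := y)) \<in> lborel \<rightarrow>\<^sub>M PiM (insert i I) (\<lambda>_. lborel)"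
      using x by measurable
    from measurable_compose[OF this meas'] have "Measurable.pred lborel (\<lambda>y. P (x(i := y)))" .
    hence "AE y in lborel. P (x(i := y))"
      by (intro AE_lborel_complex_horizontal fin) (simp add: pred_def)
    hence "AE y in lborel. indicator {x. \<not> P x} (x(i := y)) = (0 :: ennreal)"
      by eventually_elim simp
    from nn_integral_cong_AE[OF this] show ?thesis by simp
  qed
  have mi: "(\<lambda>x. indicator {x. \<not> P x} x :: ennreal) \<in> borel_measurable (PiM (insert i I) (\<lambda>_. lborel))"
    using meas' unfolding indicator_def by measurable
  have "integral\<^sup>N (PiM (insert i I) (\<lambda>_. lborel)) (indicator {x. \<not> P x}) =
      (\<integral>\<^sup>+ x. (\<integral>\<^sup>+ y. indicator {x. \<not> P x} (x(i := y)) \<partial>lborel) \<partial>PiM I (\<lambda>_. lborel))"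
    using I mi by (intro product_nn_integral_insert) auto
  also have "\<dots> = 0"
    using zero by (subst nn_integral_cong[where v = "\<lambda>_. 0"]) auto
  finally have "integral\<^sup>N (PiM (insert i I) (\<lambda>_. lborel)) (indicator {x. \<not> P x}) = 0" .
  hence "AE x in PiM (insert i I) (\<lambda>_. lborel). indicator {x. \<not> P x} x = (0 :: ennreal)"
    using mi by (subst (asm) nn_integral_0_iff_AE) auto
  hence "AE x in PiM {..<N} (\<lambda>_. lborel). indicator {x. \<not> P x} x = (0 :: ennreal)"
    by (simp only: I)
  thus ?thesis
    by eventually_elim (auto simp: indicator_def split: if_splits)
qed

section \<open>Determinants with a generic diagonal\<close>

text \<open>The determinant vanishes exactly when \<open>- a\<close> is an eigenvalue of
  \<open>S\<close>, and the characteristic polynomial is monic, hence nonzero.\<close>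

lemma finite_zeros_det_add_diagonal:
  fixes S :: "complex Matrix.mat"
  assumes S: "S \<in> carrier_mat n n"
  shows "finite {a::real. Determinant.det (S + of_real a \<cdot>\<^sub>m 1\<^sub>m n) = 0}"
proof -
  have "char_poly S \<noteq> 0"
    using degree_monic_char_poly[OF S] by auto
  hence "finite {z. poly (char_poly S) z = 0}"
    by (rule poly_roots_finite)
  hence "finite ((\<lambda>a::real. - complex_of_real a) -` {z. poly (char_poly S) z = 0})"
    by (rule finite_vimageI) (auto simp: inj_def)
  moreover have "(\<lambda>a::real. - complex_of_real a) -` {z. poly (char_poly S) z = 0}
      = {a::real. Determinant.det (S + of_real a \<cdot>\<^sub>m 1\<^sub>m n) = 0}"
    using S by (auto simp: eigenvalue_root_char_poly[OF S, symmetric] eigenvalue_det[OF S] char_matrix_def)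
  ultimately show ?thesis by simp
qed

text \<open>The pivot coordinate \<open>x i\<close> enters only through the diagonal, conjugated in some rows; hence on each
  line \<open>Im (x i) = const\<close> the determinant is a characteristic polynomial in \<open>Re (x i)\<close>.\<close>
lemma AE_det_pivot_nonzero:
  fixes E :: "(nat \<Rightarrow> complex) \<Rightarrow> nat \<Rightarrow> nat \<Rightarrow> complex"
  assumes "i < N"
    and meas: "\<And>s t. (\<lambda>x. E x s t) \<in> borel_measurable (PiM {..<N} (\<lambda>_. lborel))"
    and indep: "\<And>x c s t. E (x(i := c)) s t = E x s t"
  shows "AE x in PiM {..<N} (\<lambda>_. (lborel :: complex measure)).
    Determinant.det (Matrix.mat n n
      (\<lambda>(s, t). (if s = t then if s < K then cnj (x i) else x i else 0) + E x s t)) \<noteq> 0"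
proof (rule AE_PiM_coordinate[OF assms(1)])
  define M where "M = (\<lambda>x :: nat \<Rightarrow> complex. Matrix.mat n n
      (\<lambda>(s, t). (if s = t then if s < K then cnj (x i) else x i else 0) + E x s t))"
  have M: "M x \<in> carrier_mat n n" for x
    by (simp add: M_def)
  have [measurable]: "(\<lambda>x. x i) \<in> borel_measurable (PiM {..<N} (\<lambda>_. lborel :: complex measure))"
    using measurable_component_singleton[of i "{..<N}" "\<lambda>_. lborel :: complex measure"] assms(1)
    by simp
  have [measurable]: "(\<lambda>x. cnj (x i)) \<in> borel_measurable (PiM {..<N} (\<lambda>_. lborel :: complex measure))"
    by (rule borel_measurable_continuous_on[OF continuous_on_cnj[OF continuous_on_id]]) measurable
  note meas[measurable]
  \<comment> \<open>The Leibniz formula reduces measurability of the determinant to that of the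
    entries.\<close>
  have det: "Determinant.det (M x) = (\<Sum>p\<in>{p. p permutes {0..<n}}. signof p *
      (\<Prod>s = 0..<n. (if s = p s then if s < K then cnj (x i) else x i else 0) + E x s (p s)))" for x
    unfolding det_def'[OF M]
    by (intro sum.cong prod.cong arg_cong2[where f = "(*)"] refl) (auto simp: M_def permutes_in_image)
  have "(\<lambda>x. Determinant.det (M x)) \<in> borel_measurable (PiM {..<N} (\<lambda>_. lborel))"
    unfolding det by measurable
  thus "Measurable.pred (PiM {..<N} (\<lambda>_. lborel)) (\<lambda>x. Determinant.det (M x) \<noteq> 0)"
    by measurable
  fix x :: "nat \<Rightarrow> complex" and b :: real
  \<comment> \<open>The pivot \<open>Complex a b\<close> and its conjugate share the real part
    \<open>a\<close>; splitting it off leaves plus or minus \<open>\<i> * b\<close> on the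
    diagonal.\<close>
  define S where "S = Matrix.mat n n
      (\<lambda>(s, t). (if s = t then if s < K then - \<i> * b else \<i> * b else 0) + E x s t)"
  have "M (x(i := Complex a b)) = S + of_real a \<cdot>\<^sub>m 1\<^sub>m n" for a
    by (rule eq_matI) (auto simp: M_def S_def indep complex_eq_iff)
  moreover have "S \<in> carrier_mat n n"
    by (simp add: S_def)
  ultimately show "finite {a. \<not> Determinant.det (M (x(i := Complex a b))) \<noteq> 0}"
    using finite_zeros_det_add_diagonal by simp
qed

section \<open>Extracting single lags from the Fourier samples\<close>

text \<open>Lagrange interpolation at \<open>card S\<close> nodes reproduces every monomial of
  degree below \<open>card S\<close>. The weights are the coefficients of degree \<open>l\<close> of
  the Lagrange basis polynomials.\<close>

lemma exists_lagrange_weights: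
  fixes z :: "nat \<Rightarrow> complex"
  assumes "finite S" "inj_on z S" "l < card S"
  shows "\<exists>c. \<forall>l' < card S. (\<Sum>m\<in>S. c m * z m ^ l') = (if l' = l then 1 else 0)"
proof -
  define p where "p = (\<lambda>m. Polynomial.smult (1 / (\<Prod>i\<in>S - {m}. z m - z i)) (\<Prod>i\<in>S - {m}. [:- z i, 1:]))"
  have nz: "(\<Prod>i\<in>S - {m}. z m - z i) \<noteq> 0" if "m \<in> S" for m
    using assms that by (auto simp: inj_on_def)
  have poly_p: "poly (p m) (z m') = (if m' = m then 1 else 0)" if "m \<in> S" "m' \<in> S" for m m'
  proof (cases "m' = m")
    case True
    thus ?thesis using nz[OF that(1)] by (simp add: p_def poly_prod)
  next
    case False
    hence "(\<Prod>i\<in>S - {m}. z m' - z i) = 0" using assms that by (intro prod_zero) auto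
    thus ?thesis using False by (simp add: p_def poly_prod)
  qed
  have deg_p: "degree (p m) < card S" if "m \<in> S" for m
  proof -
    have "degree (p m) \<le> degree (\<Prod>i\<in>S - {m}. [:- z i, 1:])"
      unfolding p_def by (rule degree_smult_le)
    also have "\<dots> \<le> (\<Sum>i\<in>S - {m}. degree [:- z i, 1:])"
      using assms degree_prod_sum_le[of "S - {m}" "\<lambda>i. [:- z i, 1:]"] by (simp add: o_def)
    also have "\<dots> = card S - 1"
      using assms that by simp
    also have "\<dots> < card S"
      using assms by simp
    finally show ?thesis .
  qed
  have "(\<Sum>m\<in>S. coeff (p m) l * z m ^ l') = (if l' = l then 1 else 0)" if "l' < card S" for l'
  proof -
    \<comment> \<open>The interpolation error: its degree is below \<open>card S\<close>, yet it
      vanishes at all \<open>card S\<close> nodes.\<close>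
    define q where "q = Polynomial.monom 1 l' - (\<Sum>m\<in>S. Polynomial.smult (z m ^ l') (p m))"
    have "degree q < card S"
      unfolding q_def using assms that deg_p
      by (intro degree_diff_less degree_sum_less) (auto simp: degree_monom_eq intro: le_less_trans[OF degree_smult_le])
    moreover have "card (z ` S) = card S"
      using assms by (simp add: card_image)
    moreover have "z ` S \<subseteq> {y. poly q y = 0}"
    proof clarify
      fix m assume m: "m \<in> S"
      have "(\<Sum>m'\<in>S. z m' ^ l' * poly (p m') (z m)) = (\<Sum>m'\<in>S. if m' = m then z m' ^ l' else 0)"
        using m by (intro sum.cong) (auto simp: poly_p)
      thus "poly q (z m) = 0"
        using m assms by (simp add: q_def poly_monom poly_sum)
    qed
    ultimately have "q = 0"
      using card_mono[OF poly_roots_finite[of q], of "z ` S"] card_poly_roots_bound[of q]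
      by (cases "q = 0") auto
    hence "coeff (Polynomial.monom 1 l') l = coeff (\<Sum>m\<in>S. Polynomial.smult (z m ^ l') (p m)) l"
      by (simp add: q_def)
    thus ?thesis
      by (simp add: coeff_sum mult.commute coeff_monom)
  qed
  thus ?thesis by (intro exI[of _ "\<lambda>m. coeff (p m) l"]) simp
qed

text \<open>The power \<open>d\<close> of the root of unity exp(-2 pi i m / N), written with
  \<open>cis\<close> so that \<open>d\<close>, a difference of two indices (a lag), may be
  negative.\<close>

definition rootpow :: "nat \<Rightarrow> int \<Rightarrow> int \<Rightarrow> complex" where
  "rootpow N m d = cis (- 2 * pi * of_int m * of_int d / of_nat N)"

lemma rootpow_add: "rootpow N m (d + d') = rootpow N m d * rootpow N m d'"
  by (simp add: rootpow_def cis_mult ring_distribs add_divide_distrib diff_divide_distrib)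

lemma cnj_rootpow: "cnj (rootpow N m d) = rootpow N m (- d)"
  by (simp add: rootpow_def cis_cnj)

lemma rootpow_power: "rootpow N m (int l) = rootpow N m 1 ^ l"
  by (simp add: rootpow_def Complex.DeMoivre mult_ac)

lemma inj_on_rootpow:
  assumes "0 < N"
  shows "inj_on (\<lambda>m. rootpow N (int m) 1) {1..N}"
proof (rule inj_onI)
  fix m m' assume m: "m \<in> {1..N}" "m' \<in> {1..N}"
    and "rootpow N (int m) 1 = rootpow N (int m') 1"
  hence "cis (- (2 * pi * real m / real N)) = cis (- (2 * pi * real m' / real N))"
    by (simp add: rootpow_def)
  hence "exp (\<i> * of_real (- (2 * pi * real m / real N))) = exp (\<i> * of_real (- (2 * pi * real m' / real N)))"
    by (simp only: cis_conv_exp)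
  then obtain k :: int where "\<i> * of_real (- (2 * pi * real m / real N)) =
      \<i> * of_real (- (2 * pi * real m' / real N)) + of_real (of_int (2 * k) * pi) * \<i>"
    unfolding exp_eq by blast
  from arg_cong[OF this, of Im] have "- (2 * pi * real m / real N) = - (2 * pi * real m' / real N) + 2 * pi * k"
    by simp
  hence "2 * pi * real m' = 2 * pi * (real m + real_of_int k * real N)"
    using assms by (simp add: field_simps)
  hence "real m' = real m + real_of_int k * real N"
    by simp
  hence eq: "int m' = int m + k * int N"
    by (simp only: of_int_eq_iff[where 'a = real, symmetric] of_int_add of_int_mult of_int_of_nat_eq)
  show "m = m'"
  proof (cases "k = 0")
    case False
    \<comment> \<open>Two indices in \<open>{1..N}\<close> differ by less than \<open>N\<close>,
      which rules out a nonzero multiple of \<open>N\<close>.\<close>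
    hence "\<bar>k * int N\<bar> \<ge> int N"
      using assms by (simp add: abs_mult)
    thus ?thesis using eq m by auto
  qed (use eq in simp)
qed

text \<open>Lags from \<open>- D\<close> to \<open>D\<close> give a Laurent polynomial in the root
  of unity. Multiplication by the power \<open>D\<close> turns it into a polynomial of degree at
  most \<open>2 * D\<close>, for which \<open>2 * D + 1\<close> nodes suffice.\<close>

lemma exists_lag_weights:
  assumes "2 * D + 1 \<le> N" "\<bar>l\<bar> \<le> int D"
  shows "\<exists>c. \<forall>l'. \<bar>l'\<bar> \<le> int D \<longrightarrow>
    (\<Sum>m = 1..2 * D + 1. c m * rootpow N (int m) l') = (if l' = l then 1 else 0)"
proof -
  have "inj_on (\<lambda>m. rootpow N (int m) 1) {1..2 * D + 1}"
    using assms by (intro inj_on_subset[OF inj_on_rootpow[of N]]) auto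
  from exists_lagrange_weights[OF _ this, of "nat (l + int D)"] assms
  obtain c where c: "\<And>l'. l' < 2 * D + 1 \<Longrightarrow>
      (\<Sum>m = 1..2 * D + 1. c m * rootpow N (int m) 1 ^ l') = (if l' = nat (l + int D) then 1 else 0)"
    by force
  have "(\<Sum>m = 1..2 * D + 1. c m * rootpow N (int m) (int D) * rootpow N (int m) l') = (if l' = l then 1 else 0)"
    if "\<bar>l'\<bar> \<le> int D" for l'
  proof -
    have "rootpow N (int m) (int D) * rootpow N (int m) l' = rootpow N (int m) 1 ^ nat (l' + int D)" for m
    proof -
      have "int (nat (l' + int D)) = int D + l'"
        using that by linarith
      thus ?thesis
        by (metis rootpow_add rootpow_power)
    qed
    hence "(\<Sum>m = 1..2 * D + 1. c m * rootpow N (int m) (int D) * rootpow N (int m) l')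
        = (if nat (l' + int D) = nat (l + int D) then 1 else 0)"
      using c[of "nat (l' + int D)"] that by (simp add: mult.assoc)
    also have "\<dots> = (if l' = l then 1 else 0)"
      using that assms by (auto simp: nat_eq_iff)
    finally show ?thesis .
  qed
  thus ?thesis by (intro exI[of _ "\<lambda>m. c m * rootpow N (int m) (int D)"]) blast
qed

section \<open>Positive semidefinite matrices\<close>

text \<open>Let \<open>c\<close> be entry \<open>i\<close> of \<open>X\<close> applied to
  \<open>v\<close>. Moving from \<open>v\<close> by a small positive multiple of \<open>- c\<close>
  along the unit vector \<open>i\<close> would make the form negative unless
  \<open>c = 0\<close>.\<close>

lemma psd_kernel:
  assumes "hermitian N X" "psd N X"
    and q0: "(\<Sum>i<N. \<Sum>j<N. cnj (v i) * X i j * v j) = 0" and "i < N"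
  shows "(\<Sum>j<N. X i j * v j) = 0"
proof -
  define c where "c = (\<Sum>j<N. X i j * v j)"
  have herm: "X j k = cnj (X k j)" if "j < N" "k < N" for j k
    using assms(1) that unfolding hermitian_def by blast
  have expand: "(\<Sum>j<N. \<Sum>k<N. cnj (v j + s * of_bool (j = i)) * X j k * (v k + s * of_bool (k = i)))
      = s * cnj c + cnj s * c + s * cnj s * X i i" for s
  proof -
    have row: "(\<Sum>k<N. X j k * (v k + s * of_bool (k = i))) = (\<Sum>k<N. X j k * v k) + s * X j i" for j
      using \<open>i < N\<close> by (simp add: ring_distribs sum.distrib of_bool_def if_distrib[of "\<lambda>z. _ * z"] mult_ac cong: if_cong)
    have "(\<Sum>j<N. \<Sum>k<N. cnj (v j + s * of_bool (j = i)) * X j k * (v k + s * of_bool (k = i)))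
        = (\<Sum>j<N. cnj (v j + s * of_bool (j = i)) * ((\<Sum>k<N. X j k * v k) + s * X j i))"
      by (simp add: row[symmetric] sum_distrib_left mult.assoc)
    also have "\<dots> = (\<Sum>j<N. cnj (v j) * (\<Sum>k<N. X j k * v k)) + s * (\<Sum>j<N. cnj (v j) * X j i)
        + (\<Sum>j<N. if j = i then cnj s * ((\<Sum>k<N. X i k * v k) + s * X i i) else 0)"
    proof -
      have "cnj (v j + s * of_bool (j = i)) * ((\<Sum>k<N. X j k * v k) + s * X j i)
          = cnj (v j) * (\<Sum>k<N. X j k * v k) + s * (cnj (v j) * X j i)
            + (if j = i then cnj s * ((\<Sum>k<N. X i k * v k) + s * X i i) else 0)" for j
        by (cases "j = i") (simp_all add: algebra_simps)
      thus ?thesis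
        by (simp only: sum.distrib sum_distrib_left[of s])
    qed
    also have "(\<Sum>j<N. cnj (v j) * (\<Sum>k<N. X j k * v k)) = 0"
      using q0 by (simp add: sum_distrib_left mult.assoc)
    also have "(\<Sum>j<N. cnj (v j) * X j i) = cnj c"
    proof -
      have "cnj (v j) * X j i = cnj (X i j * v j)" if "j < N" for j
        using herm[OF that \<open>i < N\<close>] by simp
      thus ?thesis
        unfolding c_def cnj_sum by (intro sum.cong refl) simp
    qed
    finally show ?thesis
      using \<open>i < N\<close> by (simp add: c_def algebra_simps)
  qed
  have nonneg: "0 \<le> Re (s * cnj c + cnj s * c + s * cnj s * X i i)" for s
    using spec[OF assms(2)[unfolded psd_def Let_def], of "\<lambda>j. v j + s * of_bool (j = i)"]
    unfolding expand by (rule conjunct2)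
  \<comment> \<open>Small enough for the linear term to dominate the quadratic one; the added 1
    avoids division by zero.\<close>
  define t where "t = 1 / (\<bar>Re (X i i)\<bar> + 1)"
  have t: "0 < t" "t * Re (X i i) < 1"
    by (auto simp: t_def field_simps)
  define q where "q = (cmod c)\<^sup>2"
  have cc: "c * cnj c = of_real q"
    unfolding q_def by (rule complex_norm_square[symmetric])
  have "- of_real t * c * cnj c + cnj (- of_real t * c) * c + (- of_real t * c) * cnj (- of_real t * c) * X i i
      = - 2 * of_real t * (c * cnj c) + of_real (t\<^sup>2) * (c * cnj c) * X i i"
    by (simp add: algebra_simps power2_eq_square)
  also have "\<dots> = of_real (- 2 * t * q) + of_real (t\<^sup>2 * q) * X i i"
    unfolding cc by simp
  finally have "- of_real t * c * cnj c + cnj (- of_real t * c) * c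
      + (- of_real t * c) * cnj (- of_real t * c) * X i i = of_real (- 2 * t * q) + of_real (t\<^sup>2 * q) * X i i" .
  moreover have "Re (of_real (- 2 * t * q) + of_real (t\<^sup>2 * q) * X i i) = - (t * (2 - t * Re (X i i)) * q)"
    by (simp add: algebra_simps power2_eq_square)
  ultimately have "t * (2 - t * Re (X i i)) * q \<le> 0"
    using nonneg[of "- of_real t * c"] by (simp only: neg_0_le_iff_le)
  moreover have "0 < t * (2 - t * Re (X i i))"
    using t by simp
  ultimately have "q \<le> 0"
    by (meson mult_pos_pos not_le)
  thus ?thesis by (simp add: c_def q_def)
qed

lemma sum_two_support:
  fixes f :: "nat \<Rightarrow> complex"
  assumes "0 < k" "k < N"
  shows "(\<Sum>j<N. f j * (if j = 0 then a else if j = k then b else 0)) = f 0 * a + f k * b"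
proof -
  have "(\<Sum>j<N. f j * (if j = 0 then a else if j = k then b else 0)) =
      (\<Sum>j\<in>{0, k}. f j * (if j = 0 then a else if j = k then b else 0))"
    using assms by (intro sum.mono_neutral_right) auto
  thus ?thesis using assms by simp
qed

text \<open>The vector \<open>v\<close> is chosen so that row 0 of \<open>X\<close> annihilates it;
  the form at \<open>v\<close> is then \<open>X 0 0\<close> times the principal minor on the indices
  \<open>0\<close> and \<open>k\<close>.\<close>

lemma psd_schur_vector_form:
  assumes "hermitian N X" "0 < k" "k < N"
  defines "v \<equiv> (\<lambda>j. if j = 0 then X 0 k else if j = k then - X 0 0 else 0)"
  shows "(\<Sum>j<N. X i j * v j) = X i 0 * X 0 k - X i k * X 0 0"
    and "(\<Sum>i<N. \<Sum>j<N. cnj (v i) * X i j * v j) = X 0 0 * (X k k * X 0 0 - X k 0 * X 0 k)"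
proof -
  have herm: "cnj (X k 0) = X 0 k" "cnj (X 0 k) = X k 0" "cnj (X 0 0) = X 0 0"
    using assms(1-3) unfolding hermitian_def by (metis complex_cnj_cnj less_trans)+
  show row: "(\<Sum>j<N. X i j * v j) = X i 0 * X 0 k - X i k * X 0 0" for i
    unfolding v_def by (subst sum_two_support[OF assms(2,3)]) simp
  have "(\<Sum>i<N. \<Sum>j<N. cnj (v i) * X i j * v j) = (\<Sum>i<N. (X i 0 * X 0 k - X i k * X 0 0) * cnj (v i))"
    unfolding row[symmetric] by (simp add: sum_distrib_left sum_distrib_right mult_ac)
  also have "\<dots> = (\<Sum>i<N. (X i 0 * X 0 k - X i k * X 0 0)
      * (if i = 0 then X k 0 else if i = k then - X 0 0 else 0))"
    by (intro sum.cong arg_cong2[where f = "(*)"] refl) (simp add: v_def herm)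
  also have "\<dots> = X 0 0 * (X k k * X 0 0 - X k 0 * X 0 k)"
    by (subst sum_two_support[OF assms(2,3)]) (simp add: algebra_simps)
  finally show "(\<Sum>i<N. \<Sum>j<N. cnj (v i) * X i j * v j) = X 0 0 * (X k k * X 0 0 - X k 0 * X 0 k)" .
qed

text \<open>A vanishing minor makes the form vanish at that vector, which is therefore in the kernel
  of \<open>X\<close>; row \<open>j\<close> of this kernel relation is the claim.\<close>

lemma psd_rank_one_column:
  assumes "hermitian N X" "psd N X" "k < N" "j < N" "X k k * X 0 0 = X k 0 * X 0 k"
  shows "X j k * X 0 0 = X j 0 * X 0 k"
proof (cases "k = 0")
  case False
  hence k: "0 < k" by simp
  note f = psd_schur_vector_form[OF assms(1) k assms(3)]
  have "(\<Sum>i<N. X j i * (if i = 0 then X 0 k else if i = k then - X 0 0 else 0)) = 0"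
    by (rule psd_kernel[OF assms(1,2) _ assms(4)]) (simp add: f(2) assms(5))
  thus ?thesis by (simp add: f(1))
qed simp

text \<open>For \<open>k > 0\<close> this is nonnegativity of the form at the same vector, after
  cancelling the fourth power of \<open>cmod z\<close>.\<close>

lemma psd_diagonal_lower_bound:
  assumes "hermitian N X" "psd N X" "k < N" "z \<noteq> 0" "X 0 0 = z * cnj z" "X k 0 = y * cnj z"
  shows "Im (X k k) = 0" "(cmod y)\<^sup>2 \<le> Re (X k k)"
proof -
  have herm: "X i j = cnj (X j i)" if "i < N" "j < N" for i j
    using assms(1) that unfolding hermitian_def by blast
  have im: "Im (X k k) = 0"
    using arg_cong[OF herm[OF assms(3,3)], of Im] by simp
  hence re: "X k k = of_real (Re (X k k))"
    by (simp add: complex_eq_iff)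
  show "Im (X k k) = 0" by (fact im)
  show "(cmod y)\<^sup>2 \<le> Re (X k k)"
  proof (cases "k = 0")
    case True
    hence "y = z" using assms(4-6) by simp
    thus ?thesis using assms(5) True by (simp add: complex_mult_cnj cmod_power2)
  next
    case False
    hence k: "0 < k" by simp
    have X0k: "X 0 k = cnj y * z"
      using herm[of 0 k] assms(3,6) k by simp
    define v where "v = (\<lambda>j. if j = 0 then X 0 k else if j = k then - X 0 0 else 0)"
    have "0 \<le> Re (\<Sum>i<N. \<Sum>j<N. cnj (v i) * X i j * v j)"
      using assms(2) unfolding psd_def Let_def by blast
    also have "(\<Sum>i<N. \<Sum>j<N. cnj (v i) * X i j * v j) = X 0 0 * (X k k * X 0 0 - X k 0 * X 0 k)"
      unfolding v_def by (rule psd_schur_vector_form(2)[OF assms(1) k assms(3)])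
    also have "\<dots> = (z * cnj z) * (z * cnj z) * (X k k - y * cnj y)"
      unfolding assms(5,6) X0k by (simp add: algebra_simps)
    also have "\<dots> = of_real ((cmod z)\<^sup>2 * (cmod z)\<^sup>2 * (Re (X k k) - (cmod y)\<^sup>2))"
      by (subst re) (simp add: complex_norm_square[symmetric])
    finally show ?thesis
      using assms(4) by (simp add: zero_le_mult_iff)
  qed
qed

section \<open>Generic injectivity of one frame\<close>

text \<open>The linearised measurements of a frame with known indices up to \<open>p\<close> and \<open>K\<close> new ones: with \<open>Y\<close> the
  difference of \<open>X\<close> and the rank-one matrix of \<open>x\<close>, one has \<open>Y k i = \<delta> k * cnj (x i)\<close> for new \<open>k\<close>
  and known \<open>i\<close>, and \<open>\<epsilon>\<close> is \<open>\<delta>\<close> weighted by the window \<open>g\<close>.\<close>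
definition frame_injective :: "nat \<Rightarrow> nat \<Rightarrow> nat \<Rightarrow> (nat \<Rightarrow> complex) \<Rightarrow> (nat \<Rightarrow> complex) \<Rightarrow> bool" where
  "frame_injective N p K g x \<longleftrightarrow> (\<forall>\<epsilon> T.
     (\<forall>m\<in>{1..4 * K - 1}.
       (\<Sum>k\<in>{p<..p + K}. \<Sum>i\<le>p.
          \<epsilon> k * cnj (g i * x i) * rootpow N (int m) (int k - int i)
          + cnj (\<epsilon> k) * (g i * x i) * rootpow N (int m) (int i - int k))
       + (\<Sum>k\<in>{p<..p + K}. \<Sum>l\<in>{p<..p + K}. T k l * rootpow N (int m) (int k - int l)) = 0)
     \<longrightarrow> (\<forall>k\<in>{p<..p + K}. \<epsilon> k = 0))"

lemma sum_atLeastLessThan_double: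
  fixes f :: "nat \<Rightarrow> 'a :: comm_monoid_add"
  shows "(\<Sum>t = 0..<2 * K. f t) = (\<Sum>t<K. f t) + (\<Sum>t<K. f (t + K))"
proof -
  have "(\<Sum>t = 0..<2 * K. f t) = (\<Sum>t = 0..<K. f t) + (\<Sum>t = K..<2 * K. f t)"
    by (rule sum.atLeastLessThan_concat[symmetric]) auto
  also have "(\<Sum>t = K..<2 * K. f t) = (\<Sum>t = 0..<K. f (t + K))"
    using sum.shift_bounds_nat_ivl[of f 0 K K] by (simp add: mult_2)
  finally show ?thesis by (simp add: atLeast0LessThan)
qed

text \<open>If the new entries are indexed by \<open>t < K\<close>, the pivot \<open>p + 1 - K\<close> contributes the new entry \<open>t\<close> to
  the lag \<open>K + t\<close> and its conjugate to \<open>- K - t\<close>, while the block \<open>T\<close> only has lags of modulus less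
  than \<open>K\<close>. Extracting the lags \<open>K..<2 * K\<close> therefore isolates the pivot.\<close>
lemma AE_frame_injective:
  assumes "0 < K" "K \<le> p + 1" "p + K < N" "4 * K - 1 \<le> N" "g (p + 1 - K) \<noteq> 0"
  shows "AE x in PiM {..<N} (\<lambda>_. (lborel :: complex measure)). frame_injective N p K g x"
proof -
  define i0 where "i0 = p + 1 - K"
  define J where "J = {..p} - {i0}"
  have i0: "i0 < N" "i0 \<le> p" "int i0 = int p + 1 - int K" "g i0 \<noteq> 0"
    using assms by (auto simp: i0_def)
  \<comment> \<open>With \<open>D = 2 * K - 1\<close>, the lags from \<open>- D\<close> to
    \<open>D\<close> number \<open>4 * K - 1\<close>, which is the number of samples.\<close>
  have four: "2 * (2 * K - 1) + 1 = 4 * K - 1"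
    using assms(1) by simp
  have "\<exists>c. \<forall>l'. \<bar>l'\<bar> \<le> int (2 * K - 1) \<longrightarrow>
      (\<Sum>m = 1..4 * K - 1. c m * rootpow N (int m) l') = (if l' = int (K + s) then 1 else 0)"
    if "s < K" for s
    using exists_lag_weights[of "2 * K - 1" N "int (K + s)"] that assms(4) unfolding four by auto
  then obtain c where c: "\<And>s l'. s < K \<Longrightarrow> \<bar>l'\<bar> \<le> int (2 * K - 1) \<Longrightarrow>
      (\<Sum>m = 1..4 * K - 1. c s m * rootpow N (int m) l') = (if l' = int (K + s) then 1 else 0)"
    by metis
  define G where "G = (\<lambda>s d. \<Sum>m = 1..4 * K - 1. c s m * rootpow N (int m) d)"
  have G: "G s d = (if d = int (K + s) then 1 else 0)" if "s < K" "\<bar>d\<bar> \<le> int (2 * K - 1)" for s d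
    using c[OF that] by (simp add: G_def)
  \<comment> \<open>Contributions of the known entries other than the pivot. Dividing by
    \<open>cnj (g i0)\<close> leaves the bare \<open>cnj (x i0)\<close> on the diagonal. Lags beyond
    \<open>2 * K - 1\<close> may occur, so \<open>G\<close> stays unevaluated here.\<close>
  define A where "A = (\<lambda>x s t. (\<Sum>i\<in>J. cnj (g i * x i) * G s (int (p + 1 + t) - int i)) / cnj (g i0))"
  define B where "B = (\<lambda>x s t. (\<Sum>i\<in>J. g i * x i * G s (int i - int (p + 1 + t))) / cnj (g i0))"
  \<comment> \<open>The equations are only real-linear. Taking the conjugates of the unknowns as
    further unknowns and the conjugated equations as further rows gives a square complex-linear
    system.\<close>
  define E where "E = (\<lambda>x s t. if s < K then (if t < K then A x s t else B x s (t - K))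
      else (if t < K then cnj (B x (s - K) t) else cnj (A x (s - K) (t - K))))"
  define M where "M = (\<lambda>x. Matrix.mat (2 * K) (2 * K)
      (\<lambda>(s, t). (if s = t then if s < K then cnj (x i0) else x i0 else 0) + E x s t))"
  have comp: "(\<lambda>x. x i) \<in> borel_measurable (PiM {..<N} (\<lambda>_. lborel :: complex measure))" if "i \<in> J" for i
    using measurable_component_singleton[of i "{..<N}" "\<lambda>_. lborel :: complex measure"] that assms(3)
    by (auto simp: J_def)
  have cnj_meas: "(\<lambda>x. cnj (f x)) \<in> borel_measurable Q" if "f \<in> borel_measurable Q"
    for f :: "(nat \<Rightarrow> complex) \<Rightarrow> complex" and Q
    using borel_measurable_continuous_on[OF continuous_on_cnj[OF continuous_on_id] that] by simp
  have mA: "(\<lambda>x. A x s t) \<in> borel_measurable (PiM {..<N} (\<lambda>_. lborel))" for s t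
    unfolding A_def by (intro borel_measurable_divide borel_measurable_sum borel_measurable_times
        borel_measurable_const cnj_meas comp)
  have mB: "(\<lambda>x. B x s t) \<in> borel_measurable (PiM {..<N} (\<lambda>_. lborel))" for s t
    unfolding B_def by (intro borel_measurable_divide borel_measurable_sum borel_measurable_times
        borel_measurable_const comp)
  have "AE x in PiM {..<N} (\<lambda>_. (lborel :: complex measure)). Determinant.det (M x) \<noteq> 0"
    unfolding M_def
  proof (rule AE_det_pivot_nonzero[OF i0(1)])
    show "(\<lambda>x. E x s t) \<in> borel_measurable (PiM {..<N} (\<lambda>_. lborel))" for s t
      unfolding E_def using mA mB cnj_meas[OF mA] cnj_meas[OF mB] by simp
    have AB: "A (x(i0 := c)) s t = A x s t" "B (x(i0 := c)) s t = B x s t" for x c s t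
      unfolding A_def B_def by (intro arg_cong2[where f = "(/)"] sum.cong refl; simp add: J_def)+
    show "E (x(i0 := c)) s t = E x s t" for x c s t
      by (simp add: E_def AB)
  qed
  thus ?thesis
  proof eventually_elim
    case (elim x)
    show ?case
      unfolding frame_injective_def
    proof (intro allI impI)
      fix \<epsilon> :: "nat \<Rightarrow> complex" and T :: "nat \<Rightarrow> nat \<Rightarrow> complex"
      let ?U = "{p<..p + K}"
      assume eq: "\<forall>m\<in>{1..4 * K - 1}.
         (\<Sum>k\<in>?U. \<Sum>i\<le>p. \<epsilon> k * cnj (g i * x i) * rootpow N (int m) (int k - int i)
            + cnj (\<epsilon> k) * (g i * x i) * rootpow N (int m) (int i - int k))
         + (\<Sum>k\<in>?U. \<Sum>l\<in>?U. T k l * rootpow N (int m) (int k - int l)) = 0"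
      define y where "y = (\<lambda>t. \<epsilon> (p + 1 + t))"
      have lag: "cnj (x i0) * y s + (\<Sum>t<K. A x s t * y t) + (\<Sum>t<K. B x s t * cnj (y t)) = 0"
        if s: "s < K" for s
      proof -
        have "0 = (\<Sum>m = 1..4 * K - 1. c s m * ((\<Sum>k\<in>?U. \<Sum>i\<le>p. \<epsilon> k * cnj (g i * x i) * rootpow N (int m) (int k - int i)
            + cnj (\<epsilon> k) * (g i * x i) * rootpow N (int m) (int i - int k))
            + (\<Sum>k\<in>?U. \<Sum>l\<in>?U. T k l * rootpow N (int m) (int k - int l))))"
          using eq by simp
        also have "\<dots> = (\<Sum>m = 1..4 * K - 1. \<Sum>k\<in>?U. \<Sum>i\<le>p. c s m * (\<epsilon> k * cnj (g i * x i) * rootpow N (int m) (int k - int i)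
            + cnj (\<epsilon> k) * (g i * x i) * rootpow N (int m) (int i - int k)))
            + (\<Sum>m = 1..4 * K - 1. \<Sum>k\<in>?U. \<Sum>l\<in>?U. c s m * (T k l * rootpow N (int m) (int k - int l)))"
          by (simp add: distrib_left sum.distrib sum_distrib_left)
        also have "(\<Sum>m = 1..4 * K - 1. \<Sum>k\<in>?U. \<Sum>l\<in>?U. c s m * (T k l * rootpow N (int m) (int k - int l)))
            = (\<Sum>k\<in>?U. \<Sum>m = 1..4 * K - 1. \<Sum>l\<in>?U. c s m * (T k l * rootpow N (int m) (int k - int l)))"
          by (rule sum.swap)
        also have "\<dots> = (\<Sum>k\<in>?U. \<Sum>l\<in>?U. \<Sum>m = 1..4 * K - 1. c s m * (T k l * rootpow N (int m) (int k - int l)))"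
          by (intro sum.cong refl sum.swap)
        also have "\<dots> = (\<Sum>k\<in>?U. \<Sum>l\<in>?U. T k l * G s (int k - int l))"
          by (simp add: G_def sum_distrib_left mult_ac)
        also have "\<dots> = 0"
          using s by (intro sum.neutral ballI) (subst G, auto)
        also have "(\<Sum>m = 1..4 * K - 1. \<Sum>k\<in>?U. \<Sum>i\<le>p. c s m * (\<epsilon> k * cnj (g i * x i) * rootpow N (int m) (int k - int i)
            + cnj (\<epsilon> k) * (g i * x i) * rootpow N (int m) (int i - int k)))
            = (\<Sum>k\<in>?U. \<Sum>m = 1..4 * K - 1. \<Sum>i\<le>p. c s m * (\<epsilon> k * cnj (g i * x i) * rootpow N (int m) (int k - int i)
            + cnj (\<epsilon> k) * (g i * x i) * rootpow N (int m) (int i - int k)))"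
          by (rule sum.swap)
        also have "\<dots> = (\<Sum>k\<in>?U. \<Sum>i\<le>p. \<Sum>m = 1..4 * K - 1. c s m * (\<epsilon> k * cnj (g i * x i) * rootpow N (int m) (int k - int i)
            + cnj (\<epsilon> k) * (g i * x i) * rootpow N (int m) (int i - int k)))"
          by (intro sum.cong refl sum.swap)
        also have "\<dots> = (\<Sum>k\<in>?U. \<Sum>i\<le>p. \<epsilon> k * cnj (g i * x i) * G s (int k - int i)
            + cnj (\<epsilon> k) * (g i * x i) * G s (int i - int k))"
          by (simp add: G_def sum_distrib_left distrib_left sum.distrib mult_ac)
        also have "?U = (\<lambda>t. p + 1 + t) ` {..<K}"
        proof -
          have "k \<in> (\<lambda>t. p + 1 + t) ` {..<K}" if "k \<in> ?U" for k
            using that by (intro image_eqI[of _ _ "k - p - 1"]) auto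
          thus ?thesis by auto
        qed
        also have "(\<Sum>k\<in>(\<lambda>t. p + 1 + t) ` {..<K}. \<Sum>i\<le>p. \<epsilon> k * cnj (g i * x i) * G s (int k - int i)
            + cnj (\<epsilon> k) * (g i * x i) * G s (int i - int k))
          = (\<Sum>t<K. \<Sum>i\<le>p. y t * cnj (g i * x i) * G s (int (p + 1 + t) - int i)
            + cnj (y t) * (g i * x i) * G s (int i - int (p + 1 + t)))"
          by (subst sum.reindex) (auto simp: inj_on_def y_def)
        also have "\<dots> = (\<Sum>t<K. (if t = s then y t * cnj (g i0 * x i0) else 0)
            + cnj (g i0) * (A x s t * y t) + cnj (g i0) * (B x s t * cnj (y t)))"
        proof (intro sum.cong refl)
          fix t assume "t \<in> {..<K}"
          hence t: "t < K" by simp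
          have "(\<Sum>i\<le>p. y t * cnj (g i * x i) * G s (int (p + 1 + t) - int i)
              + cnj (y t) * (g i * x i) * G s (int i - int (p + 1 + t)))
            = (y t * cnj (g i0 * x i0) * G s (int (p + 1 + t) - int i0)
              + cnj (y t) * (g i0 * x i0) * G s (int i0 - int (p + 1 + t)))
            + (\<Sum>i\<in>J. y t * cnj (g i * x i) * G s (int (p + 1 + t) - int i)
              + cnj (y t) * (g i * x i) * G s (int i - int (p + 1 + t)))"
            unfolding J_def using i0(2) by (intro sum.remove) auto
          also have "G s (int (p + 1 + t) - int i0) = (if t = s then 1 else 0)"
            using s t by (subst G) (auto simp: i0(3))
          also have "G s (int i0 - int (p + 1 + t)) = 0"
            using s t by (subst G) (auto simp: i0(3))
          also have "(\<Sum>i\<in>J. y t * cnj (g i * x i) * G s (int (p + 1 + t) - int i)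
              + cnj (y t) * (g i * x i) * G s (int i - int (p + 1 + t)))
            = cnj (g i0) * (A x s t * y t) + cnj (g i0) * (B x s t * cnj (y t))"
          proof -
            have "cnj (g i0) * A x s t = (\<Sum>i\<in>J. cnj (g i * x i) * G s (int (p + 1 + t) - int i))"
              "cnj (g i0) * B x s t = (\<Sum>i\<in>J. g i * x i * G s (int i - int (p + 1 + t)))"
              using i0(4) by (simp_all add: A_def B_def)
            thus ?thesis
              unfolding mult.assoc[symmetric] by (simp add: sum.distrib sum_distrib_left mult_ac)
          qed
          finally show "(\<Sum>i\<le>p. y t * cnj (g i * x i) * G s (int (p + 1 + t) - int i)
              + cnj (y t) * (g i * x i) * G s (int i - int (p + 1 + t)))
            = (if t = s then y t * cnj (g i0 * x i0) else 0)
            + cnj (g i0) * (A x s t * y t) + cnj (g i0) * (B x s t * cnj (y t))"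
            by (simp add: add.assoc)
        qed
        also have "\<dots> = cnj (g i0) * (cnj (x i0) * y s + (\<Sum>t<K. A x s t * y t) + (\<Sum>t<K. B x s t * cnj (y t)))"
          using s by (simp add: sum.distrib sum_distrib_left distrib_left)
        finally show ?thesis
          using i0(4) by simp
      qed
      define v where "v = Matrix.vec (2 * K) (\<lambda>t. if t < K then y t else cnj (y (t - K)))"
      have "M x *\<^sub>v v = 0\<^sub>v (2 * K)"
      proof (rule eq_vecI)
        fix s assume "s < dim_vec (0\<^sub>v (2 * K) :: complex Matrix.vec)"
        hence s: "s < 2 * K" by simp
        have "vec_index (M x *\<^sub>v v) s = (\<Sum>t = 0..<2 * K. ((if s = t then if s < K then cnj (x i0) else x i0 else 0) + E x s t)
            * (if t < K then y t else cnj (y (t - K))))"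
          using s by (simp add: M_def v_def scalar_prod_def)
        also have "\<dots> = (\<Sum>t = 0..<2 * K. (if s = t then (if s < K then cnj (x i0) * y s else x i0 * cnj (y (s - K))) else 0)
            + E x s t * (if t < K then y t else cnj (y (t - K))))"
          by (intro sum.cong refl) (auto simp: distrib_right)
        also have "\<dots> = (if s < K then cnj (x i0) * y s else x i0 * cnj (y (s - K)))
            + (\<Sum>t<K. E x s t * y t) + (\<Sum>t<K. E x s (t + K) * cnj (y t))"
          using s by (simp add: sum.distrib sum_atLeastLessThan_double[of "\<lambda>t. E x s t * _ t"])
        also have "\<dots> = 0"
        proof (cases "s < K")
          case True
          thus ?thesis using lag[OF True] by (simp add: E_def)
        next
          case False
          have "cnj (cnj (x i0) * y (s - K) + (\<Sum>t<K. A x (s - K) t * y t) + (\<Sum>t<K. B x (s - K) t * cnj (y t))) = 0"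
            using lag[of "s - K"] s False by simp
          thus ?thesis using False by (simp add: E_def add_ac)
        qed
        finally show "vec_index (M x *\<^sub>v v) s = vec_index (0\<^sub>v (2 * K)) s"
          using s by simp
      qed (simp add: M_def)
      moreover have "M x \<in> carrier_mat (2 * K) (2 * K)" "v \<in> carrier_vec (2 * K)"
        by (simp_all add: M_def v_def)
      ultimately have v0: "v = 0\<^sub>v (2 * K)"
        using elim det_0_iff_vec_prod_zero[of "M x" "2 * K"] by blast
      show "\<forall>k\<in>?U. \<epsilon> k = 0"
      proof
        fix k assume k: "k \<in> ?U"
        hence "k - p - 1 < K" "k = p + 1 + (k - p - 1)"
          by auto
        then obtain t where t: "t < K" "k = p + 1 + t"
          by blast
        hence "vec_index v t = \<epsilon> k"
          by (simp add: v_def y_def)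
        thus "\<epsilon> k = 0"
          using t v0 by simp
      qed
    qed
  qed
qed

section \<open>Extending the agreement by one frame\<close>

text \<open>Column 0 and the diagonal are all that has to be tracked: for \<open>x 0\<close>
  nonzero, semidefiniteness determines the rest of the block
  (\<open>agrees_upto_imp_outer\<close>).\<close>

definition agrees_upto :: "(nat \<Rightarrow> complex) \<Rightarrow> (nat \<Rightarrow> nat \<Rightarrow> complex) \<Rightarrow> nat \<Rightarrow> bool" where
  "agrees_upto x X p \<longleftrightarrow> (\<forall>n\<le>p. X n 0 = x n * cnj (x 0) \<and> X n n = x n * cnj (x n))"

text \<open>For a known index \<open>k\<close> the minor on \<open>0\<close> and \<open>k\<close>
  vanishes, so column \<open>k\<close> is a multiple of column 0, even in rows \<open>j\<close>
  beyond \<open>p\<close>. This is what makes the measurements real-linear in the unknowns.\<close>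

lemma agrees_upto_column:
  assumes "hermitian N X" "psd N X" "x 0 \<noteq> 0" "agrees_upto x X p" "k \<le> p" "k < N" "j < N"
  shows "X j k = X j 0 / cnj (x 0) * cnj (x k)"
proof -
  have X: "X k 0 = x k * cnj (x 0)" "X k k = x k * cnj (x k)" "X 0 0 = x 0 * cnj (x 0)"
    using assms(4,5) by (auto simp: agrees_upto_def)
  have "X 0 k = cnj (X k 0)"
    using assms(1,6) unfolding hermitian_def by (metis less_nat_zero_code neq0_conv)
  hence X0k: "X 0 k = cnj (x k) * x 0"
    by (simp add: X(1))
  have "X j k * X 0 0 = X j 0 * X 0 k"
    by (rule psd_rank_one_column[OF assms(1,2,6,7)]) (simp add: X X0k)
  thus ?thesis
    using assms(3) by (simp add: X(3) X0k field_simps)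
qed

lemma agrees_upto_imp_outer:
  assumes "hermitian N X" "psd N X" "x 0 \<noteq> 0" "agrees_upto x X p" "k \<le> p" "j \<le> p" "k < N" "j < N"
  shows "X j k = x j * cnj (x k)"
proof -
  have "X j 0 = x j * cnj (x 0)"
    using assms(4,6) by (auto simp: agrees_upto_def)
  thus ?thesis
    using agrees_upto_column[OF assms(1-5,7,8)] assms(3) by simp
qed

text \<open>Two halves: \<open>frame_injective\<close> gives column 0 at the new indices; after that
  only the block of new indices is left in the measurements, and its lag 0 settles the
  diagonal.\<close>

lemma agrees_upto_frame_step:
  assumes herm: "hermitian N X" and psd: "psd N X" and x0: "x 0 \<noteq> 0"
    and K: "0 < K" "p + K < N" "4 * K - 1 \<le> N"
    and known: "agrees_upto x X p"
    and g0: "\<And>k. p + K < k \<Longrightarrow> k < N \<Longrightarrow> g k = 0"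
    and gU: "\<And>k. k \<in> {p<..p + K} \<Longrightarrow> g k \<noteq> 0"
    and inj: "frame_injective N p K g x"
    and eq: "\<And>m. m \<in> {1..4 * K - 1} \<Longrightarrow> (\<Sum>k<N. \<Sum>i<N. g k * cnj (g i)
      * rootpow N (int m) (int k - int i) * (X k i - x k * cnj (x i))) = 0"
  shows "agrees_upto x X (p + K)"
proof -
  let ?U = "{p<..p + K}"
  define Y where "Y = (\<lambda>k i. X k i - x k * cnj (x i))"
  define \<delta> where "\<delta> = (\<lambda>k. X k 0 / cnj (x 0) - x k)"
  have Ycol: "Y k i = \<delta> k * cnj (x i)" if "k < N" "i \<le> p" for k i
    using agrees_upto_column[OF herm psd x0 known that(2)] that K
    by (simp add: Y_def \<delta>_def left_diff_distrib)
  have Yherm: "Y i k = cnj (Y k i)" if "i < N" "k < N" for i k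
  proof -
    have "X i k = cnj (X k i)"
      using herm that unfolding hermitian_def by blast
    thus ?thesis by (simp add: Y_def mult.commute)
  qed
  have \<delta>0: "\<delta> k = 0" if "k \<le> p" for k
    using that known x0 by (simp add: \<delta>_def agrees_upto_def)
  \<comment> \<open>To be used for terms carrying the factor \<open>g\<close>, which is zero beyond
    \<open>p + K\<close>.\<close>
  have split: "(\<Sum>k<N. f k) = (\<Sum>k\<le>p. f k) + (\<Sum>k\<in>?U. f k)"
    if "\<And>k. p + K < k \<Longrightarrow> k < N \<Longrightarrow> f k = 0" for f :: "nat \<Rightarrow> complex"
  proof -
    have "(\<Sum>k<N. f k) = (\<Sum>k\<in>{..p} \<union> ?U. f k)"
      using K that by (intro sum.mono_neutral_right) auto
    also have "\<dots> = (\<Sum>k\<le>p. f k) + (\<Sum>k\<in>?U. f k)"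
      by (intro sum.union_disjoint) auto
    finally show ?thesis .
  qed
  define \<epsilon> where "\<epsilon> = (\<lambda>k. g k * \<delta> k)"
  define T where "T = (\<lambda>k l. g k * cnj (g l) * Y k l)"
  have lag: "(\<Sum>k\<in>?U. \<Sum>i\<le>p.
          \<epsilon> k * cnj (g i * x i) * rootpow N (int m) (int k - int i)
          + cnj (\<epsilon> k) * (g i * x i) * rootpow N (int m) (int i - int k))
       + (\<Sum>k\<in>?U. \<Sum>l\<in>?U. T k l * rootpow N (int m) (int k - int l)) = 0"
    if m: "m \<in> {1..4 * K - 1}" for m
  proof -
    define F where "F = (\<lambda>k i. g k * cnj (g i) * rootpow N (int m) (int k - int i) * Y k i)"
    have F0: "F k i = 0" if "p + K < k \<and> k < N \<or> p + K < i \<and> i < N" for k i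
      using g0 that by (auto simp: F_def)
    have "0 = (\<Sum>k<N. \<Sum>i<N. F k i)"
      using eq[OF m] by (simp add: F_def Y_def)
    also have "\<dots> = (\<Sum>k<N. (\<Sum>i\<le>p. F k i) + (\<Sum>i\<in>?U. F k i))"
      by (intro sum.cong refl split F0) auto
    also have "\<dots> = (\<Sum>k\<le>p. (\<Sum>i\<le>p. F k i) + (\<Sum>i\<in>?U. F k i)) + (\<Sum>k\<in>?U. (\<Sum>i\<le>p. F k i) + (\<Sum>i\<in>?U. F k i))"
      by (intro split) (simp add: F0)
    also have "\<dots> = (\<Sum>k\<le>p. \<Sum>i\<le>p. F k i) + (\<Sum>k\<le>p. \<Sum>i\<in>?U. F k i) + (\<Sum>k\<in>?U. \<Sum>i\<le>p. F k i) + (\<Sum>k\<in>?U. \<Sum>i\<in>?U. F k i)"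
      by (simp add: sum.distrib)
    also have "(\<Sum>k\<le>p. \<Sum>i\<le>p. F k i) = 0"
      using K by (intro sum.neutral ballI) (simp add: F_def Ycol \<delta>0)
    also have "(\<Sum>k\<le>p. \<Sum>i\<in>?U. F k i) = (\<Sum>k\<in>?U. \<Sum>i\<le>p. F i k)"
      by (rule sum.swap)
    also have "\<dots> = (\<Sum>k\<in>?U. \<Sum>i\<le>p. cnj (\<epsilon> k) * (g i * x i) * rootpow N (int m) (int i - int k))"
    proof (intro sum.cong refl)
      fix k i assume "k \<in> ?U" "i \<in> {..p}"
      hence "Y i k = cnj (\<delta> k) * x i"
        using K Yherm[of i k] Ycol[of k i] by simp
      thus "F i k = cnj (\<epsilon> k) * (g i * x i) * rootpow N (int m) (int i - int k)"
        by (simp add: F_def \<epsilon>_def mult_ac)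
    qed
    also have "(\<Sum>k\<in>?U. \<Sum>i\<le>p. F k i) = (\<Sum>k\<in>?U. \<Sum>i\<le>p. \<epsilon> k * cnj (g i * x i) * rootpow N (int m) (int k - int i))"
      using K by (intro sum.cong refl) (simp add: F_def \<epsilon>_def Ycol mult_ac)
    also have "(\<Sum>k\<in>?U. \<Sum>i\<in>?U. F k i) = (\<Sum>k\<in>?U. \<Sum>l\<in>?U. T k l * rootpow N (int m) (int k - int l))"
      by (intro sum.cong refl) (simp add: F_def T_def mult_ac)
    finally show ?thesis
      by (simp add: sum.distrib add_ac)
  qed
  hence \<epsilon>0: "\<forall>k\<in>?U. \<epsilon> k = 0"
    using inj unfolding frame_injective_def by blast
  have col0: "X k 0 = x k * cnj (x 0)" if "k \<le> p + K" for k
  proof (cases "k \<le> p")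
    case True
    thus ?thesis using known by (simp add: agrees_upto_def)
  next
    case False
    hence k: "k \<in> ?U" using that by simp
    hence "\<epsilon> k = 0" using \<epsilon>0 by blast
    hence "\<delta> k = 0"
      using gU[OF k] by (simp add: \<epsilon>_def)
    thus ?thesis using x0 by (simp add: \<delta>_def field_simps)
  qed
  have block: "(\<Sum>k\<in>?U. \<Sum>l\<in>?U. T k l * rootpow N (int m) (int k - int l)) = 0"
    if "m \<in> {1..4 * K - 1}" for m
    using lag[OF that] \<epsilon>0 by simp
  have four: "2 * (2 * K - 1) + 1 = 4 * K - 1"
    using K by simp
  \<comment> \<open>Weights for lag 0, which retain the diagonal of \<open>T\<close> only.\<close>
  obtain c where c: "\<And>l'. \<bar>l'\<bar> \<le> int (2 * K - 1) \<Longrightarrow>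
      (\<Sum>m = 1..4 * K - 1. c m * rootpow N (int m) l') = (if l' = 0 then 1 else 0)"
    using exists_lag_weights[of "2 * K - 1" N 0] K unfolding four by auto
  have "0 = (\<Sum>m = 1..4 * K - 1. c m * (\<Sum>k\<in>?U. \<Sum>l\<in>?U. T k l * rootpow N (int m) (int k - int l)))"
    by (simp add: block)
  also have "\<dots> = (\<Sum>m = 1..4 * K - 1. \<Sum>k\<in>?U. \<Sum>l\<in>?U. T k l * (c m * rootpow N (int m) (int k - int l)))"
    by (simp add: sum_distrib_left mult_ac)
  also have "\<dots> = (\<Sum>k\<in>?U. \<Sum>m = 1..4 * K - 1. \<Sum>l\<in>?U. T k l * (c m * rootpow N (int m) (int k - int l)))"
    by (rule sum.swap)
  also have "\<dots> = (\<Sum>k\<in>?U. \<Sum>l\<in>?U. \<Sum>m = 1..4 * K - 1. T k l * (c m * rootpow N (int m) (int k - int l)))"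
    by (intro sum.cong refl sum.swap)
  also have "\<dots> = (\<Sum>k\<in>?U. \<Sum>l\<in>?U. if k = l then T k l else 0)"
    by (intro sum.cong refl, subst sum_distrib_left[symmetric], subst c) auto
  also have "\<dots> = (\<Sum>k\<in>?U. T k k)"
    by (intro sum.cong refl) simp
  finally have sumT: "(\<Sum>k\<in>?U. T k k) = 0" ..
  \<comment> \<open>With column 0 settled, semidefiniteness bounds the new diagonal from below; as
    its weighted excess sums to zero, no excess remains.\<close>
  have bound: "Im (X k k) = 0" "(cmod (x k))\<^sup>2 \<le> Re (X k k)" if "k \<in> ?U" for k
  proof -
    have "X 0 0 = x 0 * cnj (x 0)" "X k 0 = x k * cnj (x 0)" "k < N"
      using col0[of 0] col0[of k] that K by auto
    thus "Im (X k k) = 0" "(cmod (x k))\<^sup>2 \<le> Re (X k k)"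
      using psd_diagonal_lower_bound[OF herm psd _ x0] by blast+
  qed
  have ReT: "Re (T k k) = (cmod (g k))\<^sup>2 * (Re (X k k) - (cmod (x k))\<^sup>2)" for k
    by (simp add: T_def Y_def complex_norm_square[symmetric])
  have "(\<Sum>k\<in>?U. Re (T k k)) = 0"
    using sumT by (metis Re_sum zero_complex.sel(1))
  moreover have "0 \<le> Re (T k k)" if "k \<in> ?U" for k
    using bound[OF that] by (simp add: ReT)
  ultimately have T0: "Re (T k k) = 0" if "k \<in> ?U" for k
    using sum_nonneg_eq_0_iff[of ?U "\<lambda>k. Re (T k k)"] that by simp
  have "X k k = x k * cnj (x k)" if "k \<le> p + K" for k
  proof (cases "k \<le> p")
    case True
    thus ?thesis using known by (simp add: agrees_upto_def)
  next
    case False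
    hence k: "k \<in> ?U" using that by simp
    have "Re (X k k) = (cmod (x k))\<^sup>2"
      using T0[OF k] gU[OF k] by (simp add: ReT)
    thus ?thesis
      using bound(1)[OF k] by (simp add: complex_norm_square[symmetric] complex_eq_iff)
  qed
  thus ?thesis
    using col0 by (simp add: agrees_upto_def)
qed

section \<open>Measurements in terms of the residual matrix\<close>

text \<open>The trace is linear in \<open>X\<close> and equals \<open>Zw\<close> at the rank-one
  matrix of \<open>x\<close>, so the difference is the same functional applied to the
  residual.\<close>

lemma measurement_residual:
  fixes r :: int
  shows "mtrace N (mat_mult N (mat_mult N (mat_mult N (adjoint (Wmat W w L r))
      (outer (fvec N m) (fvec N m))) (Wmat W w L r)) X) - complex_of_real (Zw N W w L x m r)
    = (\<Sum>k<N. \<Sum>i<N. wext W w (r * int L - int k) * cnj (wext W w (r * int L - int i))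
        * rootpow N m (int k - int i) * (X k i - x k * cnj (x i)))"
proof -
  define h where "h = (\<lambda>k. wext W w (r * int L - int k))"
  define a where "a = (\<lambda>k. h k * rootpow N m (int k))"
  have f: "cnj (fvec N m k) = rootpow N m (int k)" for k
    by (simp add: fvec_def rootpow_def cis_conv_exp exp_cnj)
  have e: "exp (- \<i> * of_real (2 * pi * real_of_int m * real n / real N)) = rootpow N m (int n)" for n
    by (simp add: rootpow_def cis_conv_exp)
  have aa: "a k * cnj (a i) = h k * cnj (h i) * rootpow N m (int k - int i)" for k i
    using rootpow_add[of N m "int k" "- int i"] by (simp add: a_def cnj_rootpow)
  have m1: "mat_mult N (adjoint (Wmat W w L r)) (outer (fvec N m) (fvec N m)) i l
      = cnj (h i) * (fvec N m i * cnj (fvec N m l))" if "i < N" for i l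
    using that by (simp add: mat_mult_def adjoint_def Wmat_def outer_def h_def if_distrib[of cnj]
        if_distrib[of "\<lambda>z. z * _"] cong: if_cong)
  have m2: "mat_mult N (mat_mult N (adjoint (Wmat W w L r)) (outer (fvec N m) (fvec N m))) (Wmat W w L r) i k
      = cnj (h i) * (fvec N m i * cnj (fvec N m k)) * h k" if "i < N" "k < N" for i k
    unfolding mat_mult_def[of N "mat_mult N _ _"] m1[OF that(1)] using that(2)
    by (simp add: Wmat_def h_def if_distrib[of "\<lambda>z. _ * z"] cong: if_cong)
  have "mtrace N (mat_mult N (mat_mult N (mat_mult N (adjoint (Wmat W w L r))
      (outer (fvec N m) (fvec N m))) (Wmat W w L r)) X)
    = (\<Sum>i<N. \<Sum>k<N. cnj (h i) * (fvec N m i * cnj (fvec N m k)) * h k * X k i)"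
    unfolding mtrace_def mat_mult_def[of N "mat_mult N (mat_mult N _ _) _"]
    by (intro sum.cong refl) (simp add: m2)
  also have "\<dots> = (\<Sum>i<N. \<Sum>k<N. a k * cnj (a i) * X k i)"
    by (simp add: a_def f[symmetric] mult_ac)
  also have "\<dots> = (\<Sum>k<N. \<Sum>i<N. a k * cnj (a i) * X k i)"
    by (rule sum.swap)
  finally have tr: "mtrace N (mat_mult N (mat_mult N (mat_mult N (adjoint (Wmat W w L r))
      (outer (fvec N m) (fvec N m))) (Wmat W w L r)) X) = (\<Sum>k<N. \<Sum>i<N. a k * cnj (a i) * X k i)" .
  have "complex_of_real (Zw N W w L x m r) = (\<Sum>k<N. x k * a k) * cnj (\<Sum>i<N. x i * a i)"
    unfolding Zw_def e complex_norm_square a_def h_def by (simp add: mult.assoc)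
  also have "\<dots> = (\<Sum>k<N. \<Sum>i<N. a k * cnj (a i) * (x k * cnj (x i)))"
    by (simp add: sum_product mult_ac)
  finally show ?thesis
    unfolding tr aa[unfolded h_def] h_def by (simp add: aa[unfolded h_def] sum_subtractf right_diff_distrib)
qed

section \<open>Which frame reveals which indices\<close>

text \<open>The last index settled after frame \<open>r\<close>: the prior block for
  \<open>r = 0\<close>, afterwards the largest \<open>n < N\<close> with \<open>r * L - n\<close>
  nonnegative.\<close>

definition known_upto :: "nat \<Rightarrow> nat \<Rightarrow> nat \<Rightarrow> nat" where
  "known_upto N L r = (if r = 0 then L div 2 else min (r * L) (N - 1))"

text \<open>For \<open>r = 0\<close> the \<open>L - L div 2\<close> new indices are at most
  \<open>L div 2 + 1\<close>, so the prior block is long enough. Later, at most \<open>L\<close> new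
  indices face \<open>r * L + 1\<close> known ones. By \<open>2 * L \<le> W\<close> the pivot and
  the new indices lie inside the window.\<close>

lemma known_upto_frame:
  assumes "0 < L" "2 * L \<le> W" "2 * W \<le> N" and less: "known_upto N L r < known_upto N L (Suc r)"
  defines "p \<equiv> known_upto N L r" and "q \<equiv> known_upto N L (Suc r)"
  shows "q - p \<le> p + 1" "q < N" "q - p \<le> L" "q \<le> Suc r * L"
    "q < k \<Longrightarrow> k < N \<Longrightarrow> Suc r * L < k"
    "k \<le> q \<Longrightarrow> p + 1 - (q - p) \<le> k \<Longrightarrow> Suc r * L < W + k"
    "int (Suc r) \<le> num_frames N W L - 1"
proof -
  define z where "z = r * L"
  have q: "q = min (L + z) (N - 1)"
    by (simp add: q_def known_upto_def z_def)
  \<comment> \<open>For \<open>r > 0\<close> strict progress excludes the cap \<open>N - 1\<close>,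
    so that \<open>p\<close> is exactly \<open>r * L\<close>.\<close>
  have p: "z = 0 \<and> p = L div 2 \<or> p = z \<and> L \<le> z \<and> z < N - 1"
    using less by (auto simp: p_def known_upto_def z_def min_def split: if_splits)
  have pq: "p < q" using less by (simp add: p_def q_def)
  show "q - p \<le> p + 1" "q - p \<le> L" "q < N" "q \<le> Suc r * L"
    "q < k \<Longrightarrow> k < N \<Longrightarrow> Suc r * L < k"
    "k \<le> q \<Longrightarrow> p + 1 - (q - p) \<le> k \<Longrightarrow> Suc r * L < W + k"
    using p q pq assms(1-3) unfolding mult_Suc z_def[symmetric] min_def by (auto split: if_splits)
  have "r * L < N - 1"
    using p assms(1-3) unfolding z_def by auto
  hence "Suc r * L < N + W - 1"
    using assms(1-3) unfolding mult_Suc by linarith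
  hence "real (Suc r * L) < real N + real W - 1"
    by linarith
  hence "real (Suc r) < (real N + real W - 1) / real L"
    using assms(1) by (simp only: of_nat_mult pos_less_divide_eq of_nat_0_less_iff)
  thus "int (Suc r) \<le> num_frames N W L - 1"
    unfolding num_frames_def by linarith
qed

section \<open>Feasibility of the rank-one matrix\<close>

lemma psd_outer: "psd N (outer x x)"
  unfolding psd_def Let_def
proof
  fix v :: "nat \<Rightarrow> complex"
  have "(\<Sum>i<N. \<Sum>j<N. cnj (v i) * outer x x i j * v j) = (\<Sum>i<N. cnj (v i) * x i) * cnj (\<Sum>j<N. cnj (v j) * x j)"
    unfolding cnj_sum sum_product by (intro sum.cong refl) (simp add: outer_def mult_ac)
  also have "\<dots> = of_real ((cmod (\<Sum>i<N. cnj (v i) * x i))\<^sup>2)"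
    by (rule complex_norm_square[symmetric])
  finally show "Im (\<Sum>i<N. \<Sum>j<N. cnj (v i) * outer x x i j * v j) = 0 \<and>
      0 \<le> Re (\<Sum>i<N. \<Sum>j<N. cnj (v i) * outer x x i j * v j)"
    by simp
qed

text \<open>Feasibility reads \<open>X\<close> only at indices below \<open>N\<close>; the bound on
  \<open>L div 2\<close> places the prior block among them.\<close>

lemma feasible_outer:
  assumes "L div 2 < N" and X: "\<And>n k. n < N \<Longrightarrow> k < N \<Longrightarrow> X n k = outer x x n k"
  shows "feasible N W w L M x X"
  unfolding feasible_def
proof (intro conjI allI impI)
  show "hermitian N X"
    by (auto simp: hermitian_def X outer_def)
  have "(\<Sum>i<N. \<Sum>j<N. cnj (v i) * X i j * v j) = (\<Sum>i<N. \<Sum>j<N. cnj (v i) * outer x x i j * v j)" for v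
    by (intro sum.cong refl) (simp add: X)
  thus "psd N X"
    using psd_outer[of N x] by (simp add: psd_def)
  show "mtrace N (mat_mult N (mat_mult N (mat_mult N (adjoint (Wmat W w L r))
      (outer (fvec N m) (fvec N m))) (Wmat W w L r)) X) = complex_of_real (Zw N W w L x m r)" for m r
    unfolding eq_iff_diff_eq_0[of "mtrace _ _"] measurement_residual
    by (intro sum.neutral ballI) (simp add: X outer_def)
  show "X n k = x n * cnj (x k)" if "n \<le> L div 2" "k \<le> L div 2" for n k
    using that assms(1) X[of n k] by (simp add: outer_def)
qed

section \<open>Induction over the frames and conclusion\<close>

text \<open>The prior information is the base case; frame \<open>Suc r\<close> then carries the
  agreement from one bound to the next.\<close>

lemma feasible_imp_agrees_upto:
  assumes NWL: "0 < L" "\<forall>n<W. w n \<noteq> 0" "2 * L \<le> W" "2 * W \<le> N" "4 * L \<le> M" "M \<le> N"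
    and x0: "x 0 \<noteq> 0" and feas: "feasible N W w L M x X"
    and inj: "\<And>r. known_upto N L r < known_upto N L (Suc r) \<Longrightarrow>
      frame_injective N (known_upto N L r) (known_upto N L (Suc r) - known_upto N L r)
        (\<lambda>k. wext W w (int (Suc r) * int L - int k)) x"
  shows "agrees_upto x X (known_upto N L r)"
proof (induction r)
  case 0
  show ?case
    using feas by (simp add: agrees_upto_def known_upto_def feasible_def)
next
  case (Suc r)
  let ?p = "known_upto N L r" and ?q = "known_upto N L (Suc r)"
  define g where "g = (\<lambda>k. wext W w (int (Suc r) * int L - int k))"
  show ?case
  proof (cases "?p < ?q")
    case True
    note geo = known_upto_frame[OF NWL(1,3,4) True]
    have herm: "hermitian N X" and psd: "psd N X"
      using feas by (simp_all add: feasible_def)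
    have "agrees_upto x X (?p + (?q - ?p))"
    proof (rule agrees_upto_frame_step[where N = N and x = x and X = X and g = g, OF herm psd x0])
      show "0 < ?q - ?p" "?p + (?q - ?p) < N" "4 * (?q - ?p) - 1 \<le> N"
        using True geo(2,3) NWL by auto
      show "agrees_upto x X ?p"
        by (fact Suc.IH)
      show "frame_injective N ?p (?q - ?p) g x"
        unfolding g_def by (rule inj[OF True])
      show "g k = 0" if "?p + (?q - ?p) < k" "k < N" for k
      proof -
        have "Suc r * L < k"
          using geo(5) that True by simp
        hence "int (Suc r) * int L < int k"
          by (metis of_nat_less_iff of_nat_mult)
        thus ?thesis by (simp add: g_def wext_def)
      qed
      show "g k \<noteq> 0" if "k \<in> {?p<..?p + (?q - ?p)}" for k
      proof -
        have "k \<le> Suc r * L" "Suc r * L < W + k"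
          using geo(4,6) that True by auto
        hence "int k \<le> int (Suc r) * int L" "int (Suc r) * int L < int W + int k"
          by (metis of_nat_le_iff of_nat_mult, metis of_nat_less_iff of_nat_mult of_nat_add)
        thus ?thesis using NWL(2) by (simp add: g_def wext_def nat_less_iff)
      qed
      show "(\<Sum>k<N. \<Sum>i<N. g k * cnj (g i) * rootpow N (int m) (int k - int i) * (X k i - x k * cnj (x i))) = 0"
        if "m \<in> {1..4 * (?q - ?p) - 1}" for m
      proof -
        \<comment> \<open>At most \<open>L\<close> new indices call for at most
          \<open>4 * L - 1\<close> samples, which \<open>4 * L \<le> M\<close> provides.\<close>
        have "1 \<le> int m" "int m \<le> int M" "0 \<le> int (Suc r)" "int (Suc r) \<le> num_frames N W L - 1"
          using that geo(3,7) NWL by auto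
        hence "mtrace N (mat_mult N (mat_mult N (mat_mult N (adjoint (Wmat W w L (int (Suc r))))
            (outer (fvec N (int m)) (fvec N (int m)))) (Wmat W w L (int (Suc r)))) X)
          - complex_of_real (Zw N W w L x (int m) (int (Suc r))) = 0"
          using feas unfolding feasible_def by auto
        thus ?thesis
          unfolding measurement_residual g_def .
      qed
    qed
    thus ?thesis using True by simp
  next
    case False
    \<comment> \<open>The next bound is not larger, so the agreement is inherited.\<close>
    thus ?thesis using Suc.IH by (simp add: agrees_upto_def)
  qed
qed

theorem theorem2:
  fixes N W L M :: nat and w :: "nat \<Rightarrow> complex"
  assumes "0 < N" "0 < W" "0 < L" "0 < M"
    and "\<forall>n<W. w n \<noteq> 0"
    and "2 * L \<le> W" "2 * W \<le> N"
    and "4 * L \<le> M" "M \<le> N"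
  shows "AE x0 in PiM {..<N} (\<lambda>_. (lborel :: complex measure)).
           (\<forall>n<N. x0 n \<noteq> 0) \<longrightarrow>
           (\<forall>X. feasible N W w L M x0 X \<longleftrightarrow>
                  (\<forall>n<N. \<forall>k<N. X n k = outer x0 x0 n k))"
proof -
  \<comment> \<open>The condition involves \<open>x\<close> but not \<open>X\<close>, and there are
    countably many \<open>r\<close>; hence one null set serves all frames and all
    \<open>X\<close>.\<close>
  let ?P = "\<lambda>r x. known_upto N L r < known_upto N L (Suc r) \<longrightarrow>
      frame_injective N (known_upto N L r) (known_upto N L (Suc r) - known_upto N L r)
        (\<lambda>k. wext W w (int (Suc r) * int L - int k)) x"
  have "AE x in PiM {..<N} (\<lambda>_. (lborel :: complex measure)). ?P r x" for r
  proof (cases "known_upto N L r < known_upto N L (Suc r)")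
    case True
    let ?p = "known_upto N L r" and ?q = "known_upto N L (Suc r)"
    let ?i = "?p + 1 - (?q - ?p)"
    note geo = known_upto_frame[OF assms(3,6,7) True]
    \<comment> \<open>The pivot has to lie under the window, since \<open>AE_frame_injective\<close>
      divides by its weight.\<close>
    have "?i \<le> Suc r * L" "Suc r * L < W + ?i"
      using geo(1,4) geo(6)[of ?i] True by auto
    hence "int ?i \<le> int (Suc r) * int L" "int (Suc r) * int L < int W + int ?i"
      by (metis of_nat_le_iff of_nat_mult, metis of_nat_less_iff of_nat_mult of_nat_add)
    hence "wext W w (int (Suc r) * int L - int ?i) \<noteq> 0"
      using assms(5) by (simp add: wext_def nat_less_iff)
    hence "AE x in PiM {..<N} (\<lambda>_. (lborel :: complex measure)). frame_injective N ?p (?q - ?p)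
        (\<lambda>k. wext W w (int (Suc r) * int L - int k)) x"
      using True geo(1-3) assms by (intro AE_frame_injective) auto
    thus ?thesis by eventually_elim simp
  qed simp
  hence "AE x in PiM {..<N} (\<lambda>_. (lborel :: complex measure)). \<forall>r. ?P r x"
    unfolding AE_all_countable by (rule allI)
  thus ?thesis
  proof eventually_elim
    case (elim x)
    show ?case
    proof (intro impI allI iffI)
      assume nz: "\<forall>n<N. x n \<noteq> 0"
      fix X n k
      assume feas: "feasible N W w L M x X" and nk: "n < N" "k < N"
      have x0: "x 0 \<noteq> 0"
        using nz assms(1) by simp
      \<comment> \<open>Taking \<open>r = N\<close> is enough to reach the cap \<open>N - 1\<close>,
        because \<open>L\<close> is at least 1.\<close>
      have "agrees_upto x X (known_upto N L N)"
        using elim by (intro feasible_imp_agrees_upto[OF assms(3,5-9) x0 feas]) blast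
      moreover have "N \<le> N * L"
        using assms(3) by simp
      hence mN: "min (N * L) (N - 1) = N - 1"
        by linarith
      hence "known_upto N L N = N - 1"
        using assms(1) mN by (simp only: known_upto_def) simp
      ultimately have "agrees_upto x X (N - 1)"
        by simp
      moreover have "hermitian N X" "psd N X"
        using feas by (simp_all add: feasible_def)
      ultimately show "X n k = outer x x n k"
        using agrees_upto_imp_outer[of N X x "N - 1" k n] x0 nk by (simp add: outer_def)
    next
      fix X
      assume "\<forall>n<N. \<forall>k<N. X n k = outer x x n k"
      moreover have "L div 2 < N"
        using assms by auto
      ultimately show "feasible N W w L M x X"
        by (intro feasible_outer) auto
    qed
  qed
qed

end
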